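(* Let $n\ge 2$. The $n\times n$ matrix $\mathcal B=\left[\frac{1}{\beta(i,j)}\right]_{i,j=1}^{n}$ can be written as $$\left(L_{n}\left(\tfrac{n}{n-1}\right)L_{n-1}\left(\tfrac{n-1}{n-2}\right)\cdots L_{2}(2)\right)\left(L_{n}\left(\tfrac{n}{n-1}\right)\cdots L_{3}\left(\tfrac{3}{2}\right)\right)\cdots\left(L_{n}\left(\tfrac{n}{n-1}\right)\right)\, D\, \left(U_{n}\left(\tfrac{n}{n-1}\right)\right)\cdots\left(U_{3}\left(\tfrac{3}{2}\right)\cdots U_{n}\left(\tfrac{n}{n-1}\right)\right)\left(U_{2}(2)\cdots U_{n-1}\left(\tfrac{n-1}{n-2}\right)U_{n}\left(\tfrac{n}{n-1}\right)\right),$$ where $D=\mathrm{diag}(1,2,\ldots,n)$. Here the lower factors consist of the groups $L_n\left(\tfrac{n}{n-1}\right)L_{n-1}\left(\tfrac{n-1}{n-2}\right)\cdots L_m\left(\tfrac{m}{m-1}\right)$ for $m=2,3,\ldots,n$ multiplied from left to right in this order of $m$, and the upper factors consist of the groups $U_m\left(\tfrac{m}{m-1}\right)U_{m+1}\left(\tfrac{m+1}{m}\right)\cdots U_n\left(\tfrac{n}{n-1}\right)$ for $m=n,n-1,\ldots,2$ multiplied from left to right in this order of $m$.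
   Context: Here $\beta(x,y)=\frac{\Gamma(x)\Gamma(y)}{\Gamma(x+y)}$ is the beta function, so $\frac{1}{\beta(i,j)}=\frac{(i+j-1)!}{(i-1)!(j-1)!}$ for positive integers $i,j$. Let $E_{i,j}$ be the $n\times n$ matrix whose $(i,j)$th entry is $1$ and all others are $0$. For complex numbers $s,t$ and $2\le i,j\le n$, the elementary bidiagonal matrices are $L_i(s)=I+sE_{i,i-1}$ and $U_j(t)=I+tE_{j-1,j}$. *)

theory Defs
  imports "HOL-Analysis.Gamma_Function" "Jordan_Normal_Form.Matrix"
begin

text \<open>
  The type of matrices indexes rows and columns from 0; the definitions below take the
  1-based indices of the mathematical text, so that position \<open>(i, j)\<close> of the text is the
  library position \<open>(i - 1, j - 1)\<close>.
\<close>

definition inv_beta_mat :: "nat \<Rightarrow> complex mat" where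
  "inv_beta_mat n = mat n n (\<lambda>(a, b). 1 / Beta (of_nat (a + 1)) (of_nat (b + 1)))"

definition E_mat :: "nat \<Rightarrow> nat \<Rightarrow> nat \<Rightarrow> complex mat" where
  "E_mat n i j = mat n n (\<lambda>(a, b). if a + 1 = i \<and> b + 1 = j then 1 else 0)"

text \<open>The elementary bidiagonal matrices are meant for indices between 2 and \<open>n\<close>.\<close>

definition L_mat :: "nat \<Rightarrow> nat \<Rightarrow> complex \<Rightarrow> complex mat" where
  "L_mat n i s = 1\<^sub>m n + s \<cdot>\<^sub>m E_mat n i (i - 1)"

definition U_mat :: "nat \<Rightarrow> nat \<Rightarrow> complex \<Rightarrow> complex mat" where
  "U_mat n j t = 1\<^sub>m n + t \<cdot>\<^sub>m E_mat n (j - 1) j"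

text \<open>
  The product, from left to right, of a list of \<open>n \<times> n\<close> matrices. The library function
  \<open>prod_list\<close> does not apply, as the type of matrices has no unit.
\<close>

definition mat_prod_list :: "nat \<Rightarrow> complex mat list \<Rightarrow> complex mat" where
  "mat_prod_list n As = foldr (*) As (1\<^sub>m n)"

text \<open>
  The groups \<open>L\<^sub>n(n/(n-1)) \<cdots> L\<^sub>m(m/(m-1))\<close> (indices descending from \<open>n\<close> to \<open>m\<close>) and
  \<open>U\<^sub>m(m/(m-1)) \<cdots> U\<^sub>n(n/(n-1))\<close> (indices ascending from \<open>m\<close> to \<open>n\<close>).
\<close>

definition L_group :: "nat \<Rightarrow> nat \<Rightarrow> complex mat" where
  "L_group n m =
     mat_prod_list n (map (\<lambda>k. L_mat n k (of_nat k / (of_nat k - 1))) (rev [m..<n + 1]))"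

definition U_group :: "nat \<Rightarrow> nat \<Rightarrow> complex mat" where
  "U_group n m =
     mat_prod_list n (map (\<lambda>k. U_mat n k (of_nat k / (of_nat k - 1))) [m..<n + 1])"

end

theory Submission
  imports Defs
begin

text \<open>
  Conjugation by \<open>\<Delta> = diag(1, \<dots>, n)\<close> turns \<open>L\<^sub>k(1)\<close> into \<open>L\<^sub>k(k/(k-1))\<close>. So the lower factors
  multiply out to \<open>\<Delta> P \<Delta>\<^sup>-\<^sup>1\<close>, where \<open>P\<close> is what the same product gives when all the
  parameters are 1, and \<open>P\<close> is the lower triangular Pascal matrix. The reason for the latter is
  that, for parameters 1, a group \<open>L\<^sub>n(1) \<cdots> L\<^sub>m(1)\<close> sums the entries of a column from row
  \<open>m - 1\<close> down to the current row, and summing a column of Pascal's triangle gives the next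
  column (the hockey-stick identity). The upper factors are the transposes of the lower ones
  in the opposite order.

  Hence the right-hand side is \<open>\<Delta> P \<Delta>\<^sup>-\<^sup>1 P\<^sup>T \<Delta>\<close>. In 0-based indices its entry at \<open>(a, b)\<close> is
  \<open>(a+1) (b+1) \<Sum>\<^sub>c (a choose c) (b choose c) / (c+1)\<close>. By absorption of \<open>(a+1) / (c+1)\<close> into the
  first binomial coefficient and Vandermonde's convolution this is
  \<open>(b+1) (a+b+1 choose b+1) = (a+b+1)! / (a! b!)\<close>, which is the reciprocal beta value.

  The lemmas \<open>L_group_eq\<close> and \<open>L_groups_prod_eq\<close> carry out the first part directly on entries,
  with the factor \<open>(a+1) / (b+1)\<close> in place of the conjugation; \<open>transpose_L_groups_prod\<close> transfers
  the result to the upper factors, and \<open>sum_choose_weighted\<close> is the final summation.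
\<close>

section \<open>Products of lists of matrices\<close>

lemma mat_prod_list_Nil [simp]: "mat_prod_list n [] = 1\<^sub>m n"
  by (simp add: mat_prod_list_def)

lemma mat_prod_list_Cons [simp]: "mat_prod_list n (A # As) = A * mat_prod_list n As"
  by (simp add: mat_prod_list_def)

lemma mat_prod_list_carrier:
  "set As \<subseteq> carrier_mat n n \<Longrightarrow> mat_prod_list n As \<in> carrier_mat n n"
  by (induction As) (auto intro: mult_carrier_mat)

lemma mat_prod_list_snoc:
  assumes "set As \<subseteq> carrier_mat n n" "A \<in> carrier_mat n n"
  shows "mat_prod_list n (As @ [A]) = mat_prod_list n As * A"
  using assms
proof (induction As)
  case (Cons B As)
  then have "mat_prod_list n As \<in> carrier_mat n n"
    by (intro mat_prod_list_carrier) auto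
  with Cons show ?case
    by (simp add: assoc_mult_mat[of B n n _ n A n])
qed simp

lemma transpose_mat_prod_list:
  assumes "set As \<subseteq> carrier_mat n n"
  shows "transpose_mat (mat_prod_list n As) = mat_prod_list n (map transpose_mat (rev As))"
  using assms
proof (induction As)
  case (Cons A As)
  then have "mat_prod_list n As \<in> carrier_mat n n"
    by (intro mat_prod_list_carrier) auto
  with Cons have "transpose_mat (mat_prod_list n (A # As))
      = mat_prod_list n (map transpose_mat (rev As)) * transpose_mat A"
    by (simp add: transpose_mult[of A n n _ n])
  also have "\<dots> = mat_prod_list n (map transpose_mat (rev As) @ [transpose_mat A])"
    using Cons.prems by (intro mat_prod_list_snoc[symmetric]) auto
  finally show ?case by simp
qed simp

lemma index_mult_mat_sum:
  assumes "A \<in> carrier_mat n n" "B \<in> carrier_mat n n" "i < n" "j < n"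
  shows "(A * B) $$ (i, j) = (\<Sum>k<n. A $$ (i, k) * B $$ (k, j))"
  using assms by (simp add: scalar_prod_def lessThan_atLeast0)

section \<open>The elementary bidiagonal factors\<close>

lemma L_mat_carrier [simp]: "L_mat n i s \<in> carrier_mat n n"
  by (simp add: L_mat_def E_mat_def)

lemma transpose_L_mat: "transpose_mat (L_mat n i s) = U_mat n i s"
  by (rule eq_matI) (auto simp: L_mat_def U_mat_def E_mat_def)

text \<open>
  Right multiplication by \<open>L\<^sub>q\<^sub>+\<^sub>2(s)\<close> is a column operation: in 0-based indices it adds \<open>s\<close> times
  column \<open>q + 1\<close> to column \<open>q\<close>.
\<close>

lemma index_mult_L_mat:
  assumes A: "A \<in> carrier_mat n n" and q: "Suc q < n" and "a < n" "b < n"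
  shows "(A * L_mat n (q + 2) s) $$ (a, b)
    = A $$ (a, b) + (if b = q then s * A $$ (a, Suc q) else 0)"
proof -
  have "(A * L_mat n (q + 2) s) $$ (a, b) = (\<Sum>k<n. A $$ (a, k) * L_mat n (q + 2) s $$ (k, b))"
    using assms by (intro index_mult_mat_sum) auto
  also have "\<dots> = (\<Sum>k<n. (if k = b then A $$ (a, k) else 0)
      + (if k = Suc q then (if b = q then s * A $$ (a, k) else 0) else 0))"
    using assms by (intro sum.cong) (auto simp: L_mat_def E_mat_def)
  also have "\<dots> = A $$ (a, b) + (if b = q then s * A $$ (a, Suc q) else 0)"
    using assms by (simp add: sum.distrib)
  finally show ?thesis .
qed

section \<open>The product of the lower factors\<close>

lemma L_group_carrier [simp]: "L_group n m \<in> carrier_mat n n"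
  unfolding L_group_def by (rule mat_prod_list_carrier) auto

lemma dim_L_group [simp]: "dim_row (L_group n m) = n" "dim_col (L_group n m) = n"
  using carrier_matD[OF L_group_carrier] by auto

text \<open>
  A group is a weighted column summation: the parameters along the path from column \<open>b\<close> to
  row \<open>a\<close> telescope, \<open>(b+2)/(b+1) \<cdot> \<dots> \<cdot> (a+1)/a = (a+1)/(b+1)\<close>. The induction is downward in the
  smallest index, since lowering it appends one more factor on the right.
\<close>

lemma L_group_eq:
  assumes "q < n"
  shows "L_group n (q + 2) = mat n n (\<lambda>(a, b).
    if a = b then 1 else if q \<le> b \<and> b < a then of_nat (a + 1) / of_nat (b + 1) else 0)"
proof -
  have "q \<le> n - 1" using assms by simp
  then show ?thesis
  proof (induction rule: inc_induct)
    case base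
    show ?case
      using assms by (intro eq_matI) (auto simp: L_group_def)
  next
    case (step q)
    have q: "Suc q < n" using step.hyps by simp
    have nz: "(1 + of_nat m :: complex) \<noteq> 0" for m
      using of_nat_neq_0[of m, where ?'a = complex] by simp
    have "[q + 2..<n + 1] = (q + 2) # [Suc q + 2..<n + 1]"
      using q by (simp add: upt_conv_Cons)
    then have "L_group n (q + 2)
        = L_group n (Suc q + 2) * L_mat n (q + 2) (of_nat (q + 2) / (of_nat (q + 2) - 1))"
      unfolding L_group_def by (simp only: rev.simps map_append list.map)
        (rule mat_prod_list_snoc; auto)
    then have entry: "L_group n (q + 2) $$ (a, b) = L_group n (Suc q + 2) $$ (a, b)
        + (if b = q then of_nat (q + 2) / of_nat (q + 1) * L_group n (Suc q + 2) $$ (a, Suc q) else 0)"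
      if "a < n" "b < n" for a b
      using q that by (simp add: index_mult_L_mat del: add_2_eq_Suc')
    show ?case
    proof (rule eq_matI, goal_cases)
      case (1 a b)
      then have "a < n" "b < n" by auto
      then show ?case
        using q nz[of "Suc q"] unfolding entry[OF \<open>a < n\<close> \<open>b < n\<close>] step.IH
        by (auto simp: add_ac)
    qed auto
  qed
qed

text \<open>
  The hockey-stick identity, with the binomial coefficients shifted to begin at \<open>q + 1\<close>.
\<close>

lemma sum_choose_column:
  assumes "q < b"
  shows "(\<Sum>c\<in>{q<..a}. (c - Suc q) choose (b - Suc q)) = (if b \<le> a then (a - q) choose (b - q) else 0)"
proof (cases "q < a")
  case True
  have "(\<Sum>c\<in>{q<..a}. (c - Suc q) choose (b - Suc q)) = (\<Sum>d\<le>a - Suc q. d choose (b - Suc q))"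
    by (rule sum.reindex_bij_witness[of _ "\<lambda>d. d + Suc q" "\<lambda>c. c - Suc q"]) (use True in auto)
  also have "\<dots> = (a - q) choose (b - q)"
    using True assms sum_choose_upper[of "b - Suc q" "a - Suc q"]
    by (simp add: Suc_diff_Suc atLeast0AtMost)
  finally show ?thesis using assms True by (auto intro: binomial_eq_0)
qed (use assms in auto)

text \<open>
  The partial products from the right are the Pascal matrix bordered by an identity block of
  size \<open>q\<close>. Each further group on the left moves the apex of the triangle one step up.
\<close>

lemma L_groups_prod_eq:
  assumes "q < n"
  shows "mat_prod_list n (map (L_group n) [q + 2..<n + 1]) = mat n n (\<lambda>(a, b).
    if a = b then 1 else if q \<le> b \<and> b < a
      then of_nat ((a - q) choose (b - q)) * (of_nat (a + 1) / of_nat (b + 1)) else 0)"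
    (is "?P q = ?M q")
proof -
  have "q \<le> n - 1" using assms by simp
  then show ?thesis
  proof (induction rule: inc_induct)
    case base
    show ?case
      using assms by (intro eq_matI) auto
  next
    case (step q)
    have q: "Suc q < n" using step.hyps by simp
    have nz: "(1 + of_nat m :: complex) \<noteq> 0" for m
      using of_nat_neq_0[of m, where ?'a = complex] by simp
    have "[q + 2..<n + 1] = (q + 2) # [Suc q + 2..<n + 1]"
      using q by (simp add: upt_conv_Cons)
    then have P: "?P q = L_group n (q + 2) * ?M (Suc q)"
      using step.IH by simp
    show ?case
    proof (rule eq_matI, goal_cases)
      case (1 a b)
      then have ab: "a < n" "b < n" by auto
      let ?g = "\<lambda>c. L_group n (q + 2) $$ (a, c)"
      have G: "?g c = (if a = c then 1 else if q \<le> c \<and> c < a then of_nat (a + 1) / of_nat (c + 1) else 0)"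
        if "c < n" for c
        using that ab q L_group_eq[of q n] by simp
      have "?P q $$ (a, b) = (\<Sum>c<n. ?g c * ?M (Suc q) $$ (c, b))"
        unfolding P using ab by (intro index_mult_mat_sum) auto
      also have "\<dots> = ?M q $$ (a, b)"
      proof (cases "q < b")
        case False
        \<comment> \<open>Column \<open>b\<close> of the second factor is still a unit vector.\<close>
        have "(\<Sum>c<n. ?g c * ?M (Suc q) $$ (c, b)) = (\<Sum>c<n. if c = b then ?g c else 0)"
          using ab False by (intro sum.cong) auto
        also have "\<dots> = ?g b" using ab by simp
        finally show ?thesis using ab False by (auto simp: G simp del: add_2_eq_Suc')
      next
        case True
        let ?h = "\<lambda>c. (of_nat ((c - Suc q) choose (b - Suc q)) :: complex)"
        have "(\<Sum>c<n. ?g c * ?M (Suc q) $$ (c, b))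
            = (\<Sum>c\<in>{q<..a}. ?h c * (of_nat (a + 1) / of_nat (b + 1)))"
        proof (rule sum.mono_neutral_cong_right)
          show "\<forall>c\<in>{..<n} - {q<..a}. ?g c * ?M (Suc q) $$ (c, b) = 0"
            using ab True by (auto simp: G simp del: add_2_eq_Suc')
          show "?g c * ?M (Suc q) $$ (c, b) = ?h c * (of_nat (a + 1) / of_nat (b + 1))"
            if "c \<in> {q<..a}" for c
          proof -
            have g: "?g c = of_nat (a + 1) / of_nat (c + 1)"
              using that ab nz[of c] by (auto simp: G simp del: add_2_eq_Suc')
            have m: "?M (Suc q) $$ (c, b) = ?h c * (of_nat (c + 1) / of_nat (b + 1))"
              using that ab True nz[of c] by (auto simp: binomial_eq_0)
            show ?thesis unfolding g m using of_nat_neq_0[of c, where ?'a = complex]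
              by (simp del: of_nat_Suc of_nat_add)
          qed
        qed (use ab in auto)
        also have "\<dots> = of_nat (\<Sum>c\<in>{q<..a}. (c - Suc q) choose (b - Suc q))
            * (of_nat (a + 1) / of_nat (b + 1))"
          by (simp only: of_nat_sum sum_distrib_right)
        also have "\<dots> = ?M q $$ (a, b)"
          unfolding sum_choose_column[OF True] using ab True nz[of b] by auto
        finally show ?thesis .
      qed
      finally show ?case .
    next
      case 2
      show ?case using P by simp
    next
      case 3
      show ?case using P by simp
    qed
  qed
qed

section \<open>The upper factors and the final summation\<close>

lemma transpose_L_group: "transpose_mat (L_group n m) = U_group n m"
  unfolding L_group_def U_group_def
  by (subst transpose_mat_prod_list) (auto simp: transpose_L_mat rev_map o_def)

lemma transpose_L_groups_prod:
  "transpose_mat (mat_prod_list n (map (L_group n) ms)) = mat_prod_list n (map (U_group n) (rev ms))"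
  by (subst transpose_mat_prod_list) (auto simp: transpose_L_group rev_map o_def)

lemma inverse_Beta_of_nat:
  "1 / Beta (of_nat (a + 1)) (of_nat (b + 1)) = (fact (a + b + 1) / (fact a * fact b) :: complex)"
proof -
  have "Beta (of_nat (a + 1)) (of_nat (b + 1)) = (fact a * fact b / fact (a + b + 1) :: complex)"
    using Gamma_fact[of a, where ?'a = complex] Gamma_fact[of b, where ?'a = complex]
      Gamma_fact[of "a + b + 1", where ?'a = complex]
    by (simp add: Beta_def add_ac)
  then show ?thesis by simp
qed

text \<open>
  Absorption, \<open>(a+1) (a choose c) = (c+1) (a+1 choose c+1)\<close>, removes the denominator and turns the
  sum into Vandermonde's convolution for \<open>(a+1) + b\<close>.
\<close>

lemma sum_choose_weighted:
  assumes "b < n"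
  shows "(\<Sum>c<n. of_nat (a choose c) * of_nat (b choose c) * (of_nat (a + 1) * of_nat (b + 1) / of_nat (c + 1)))
    = (fact (a + b + 1) / (fact a * fact b) :: 'a :: field_char_0)"
proof -
  have "(\<Sum>c<n. of_nat (a choose c) * of_nat (b choose c) * (of_nat (a + 1) * of_nat (b + 1) / of_nat (c + 1)) :: 'a)
      = (\<Sum>c<n. of_nat (b + 1) * of_nat ((Suc a choose Suc c) * (b choose c)))"
  proof (rule sum.cong)
    fix c
    have "of_nat (a + 1) * of_nat (a choose c) = (of_nat (Suc a choose Suc c) * of_nat (c + 1) :: 'a)"
      unfolding Suc_eq_plus1[symmetric] of_nat_mult[symmetric] Suc_times_binomial_eq ..
    moreover have "of_nat (c + 1) \<noteq> (0 :: 'a)"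
      using of_nat_neq_0[of c] by simp
    ultimately have "of_nat (Suc a choose Suc c) = (of_nat (a + 1) * of_nat (a choose c) / of_nat (c + 1) :: 'a)"
      by (simp only: nonzero_mult_div_cancel_right not_False_eq_True)
    then show "of_nat (a choose c) * of_nat (b choose c) * (of_nat (a + 1) * of_nat (b + 1) / of_nat (c + 1))
        = (of_nat (b + 1) * of_nat ((Suc a choose Suc c) * (b choose c)) :: 'a)"
      by (simp only: of_nat_mult times_divide_eq_right times_divide_eq_left mult_ac)
  qed simp
  also have "\<dots> = of_nat (b + 1) * of_nat (\<Sum>c<n. (Suc a choose Suc c) * (b choose c))"
    by (simp only: of_nat_sum sum_distrib_left)
  also have "(\<Sum>c<n. (Suc a choose Suc c) * (b choose c)) = (\<Sum>c\<le>b. (Suc a choose Suc c) * (b choose c))"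
    using assms by (intro sum.mono_neutral_right) (auto simp: binomial_eq_0)
  also have "\<dots> = (\<Sum>c\<le>b. (Suc a choose Suc c) * (b choose (b - c)))"
    by (intro sum.cong) (auto simp: binomial_symmetric[symmetric])
  \<comment> \<open>The term for the empty choice from the first \<open>a + 1\<close> elements vanishes, as \<open>b\<close> elements
      do not have a subset of size \<open>b + 1\<close>.\<close>
  also have "\<dots> = (\<Sum>k\<le>Suc b. (Suc a choose k) * (b choose (Suc b - k)))"
    by (simp only: sum.atMost_Suc_shift diff_Suc_Suc diff_zero) (simp add: binomial_eq_0)
  also have "\<dots> = (Suc a + b) choose Suc b"
    by (rule vandermonde)
  finally show ?thesis
    using of_nat_neq_0[of b, where ?'a = 'a]
    by (simp add: binomial_fact divide_simps mult.commute[of "fact b" "fact a"] del: binomial_Suc_Suc)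
qed

theorem theorem2p8:
  fixes n :: nat
  assumes "n \<ge> 2"
  shows "inv_beta_mat n =
    mat_prod_list n (map (L_group n) [2..<n + 1])
    * mat_diag n (\<lambda>a. of_nat (a + 1))
    * mat_prod_list n (map (U_group n) (rev [2..<n + 1]))"
proof -
  let ?P = "mat_prod_list n (map (L_group n) [2..<n + 1])"
  let ?D = "mat_diag n (\<lambda>a. of_nat (a + 1)) :: complex mat"
  have carrier: "?P \<in> carrier_mat n n"
    by (rule mat_prod_list_carrier) auto
  \<comment> \<open>The binomial coefficient covers the diagonal and the zeros above it, so that no case
      distinction is left.\<close>
  have P: "?P $$ (a, b) = of_nat (a choose b) * (of_nat (a + 1) / of_nat (b + 1))"
    if "a < n" "b < n" for a b
    using L_groups_prod_eq[of 0 n] that of_nat_neq_0[of b, where ?'a = complex]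
    by (auto simp: numeral_2_eq_2 binomial_eq_0)
  show ?thesis
  proof (rule eq_matI, goal_cases)
    case (1 a b)
    then have ab: "a < n" "b < n"
      using carrier transpose_carrier_mat[of ?P n n]
      by (auto simp flip: transpose_L_groups_prod)
    have "(?P * ?D * transpose_mat ?P) $$ (a, b) = (\<Sum>c<n. (?P * ?D) $$ (a, c) * transpose_mat ?P $$ (c, b))"
      using carrier ab by (intro index_mult_mat_sum) auto
    also have "\<dots> = (\<Sum>c<n. of_nat (a choose c) * of_nat (b choose c)
        * (of_nat (a + 1) * of_nat (b + 1) / of_nat (c + 1)))"
    proof (rule sum.cong)
      fix c assume "c \<in> {..<n}"
      then have c: "c < n" by simp
      have "(?P * ?D) $$ (a, c) = ?P $$ (a, c) * of_nat (c + 1)"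
        using carrier ab c by (simp add: mat_diag_mult_right[of _ n n])
      moreover have "transpose_mat ?P $$ (c, b) = ?P $$ (b, c)"
        using carrier ab c by simp
      moreover have "of_nat (c + 1) \<noteq> (0 :: complex)" by (metis Suc_eq_plus1 of_nat_neq_0)
      ultimately show "(?P * ?D) $$ (a, c) * transpose_mat ?P $$ (c, b)
          = of_nat (a choose c) * of_nat (b choose c) * (of_nat (a + 1) * of_nat (b + 1) / of_nat (c + 1))"
        by (simp only: P[OF ab(1) c] P[OF ab(2) c]) (simp del: of_nat_Suc of_nat_add)
    qed simp
    also have "\<dots> = inv_beta_mat n $$ (a, b)"
      unfolding sum_choose_weighted[OF ab(2)] inv_beta_mat_def
      using ab by (simp only: index_mat split_conv inverse_Beta_of_nat)
    finally show ?case by (simp only: transpose_L_groups_prod)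
  next
    case 2
    then show ?case using carrier by (simp add: inv_beta_mat_def)
  next
    case 3
    then show ?case
      using carrier by (simp add: inv_beta_mat_def flip: transpose_L_groups_prod)
  qed
qed

end
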